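(* Let $d\ge2$ and consider the $2$-Lipschitz interface dynamics with independent Bernoulli disorder of parameter $p$ described in the context. There exists $p_0<1$ such that for every $p\in(p_0,1]$, almost surely there are infinitely many blocked ($2$-Lipschitz) surfaces $S:\mathbb{Z}^{d-1}\to\mathbb{Z}$.
   Context: Points of $\mathbb{Z}^d$ are written $(x,y)$, $x\in\mathbb{Z}^{d-1}$, $y\in\mathbb{Z}$. The environment consists of independent random variables $\omega(x,y)$, $(x,y)\in\mathbb{Z}^d$, with $$p=\mathbb{P}\big(\omega(x,y)=-3(d-1)\big)=1-\mathbb{P}\big(\omega(x,y)=1/2\big).$$ A surface $S:\mathbb{Z}^{d-1}\to\mathbb{Z}$ is $2$-Lipschitz if $|S(x)-S(x')|\le2$ for all nearest neighbours $x,x'$. Let $E=\{\pm e_k:k=1,\dots,d-1\}$, $\partial_eS(x)=S(x+e)-S(x)$ and $\Delta S(x)=\sum_{e\in E}\partial_eS(x)$. The evolution is $S_{t+1}(x)=S_t(x)+F\big((\partial_eS_t(x))_{e\in E};\omega(x,S_t(x))\big)$ with $$F(a_1,\dots,a_{2(d-1)},w)=1_{\{a_k>-2\text{ for all }k\}}\ \max\Big(1_{\{a_k=2\text{ for some }k\}},\ 1_{\{a_1+\dots+a_{2(d-1)}+w>0\}}\Big).$$ It preserves the set of $2$-Lipschitz surfaces. A surface $S$ is blocked if one step of this evolution started from $S$ leaves $S(x)$ unchanged for every $x\in\mathbb{Z}^{d-1}$. *)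

theory Defs
  imports "HOL-Probability.Probability"
begin

text \<open>
  The dimension is \<open>d = CARD('n) + 1\<close>: a site of the \<open>d\<close>-dimensional integer lattice is a pair of
  type \<open>(int ^ 'n) \<times> int\<close>. As \<open>'n\<close> ranges over the (nonempty) finite types, \<open>d\<close> ranges over all
  integers \<open>d \<ge> 2\<close>.
\<close>

type_synonym 'n site = "(int ^ 'n) \<times> int"
type_synonym 'n surface = "int ^ 'n \<Rightarrow> int"

definition unit_steps :: "(int ^ 'n::finite) set" where
  "unit_steps = range (\<lambda>k. axis k 1) \<union> range (\<lambda>k. - axis k 1)"

definition two_Lipschitz :: "'n::finite surface \<Rightarrow> bool" where
  "two_Lipschitz S \<longleftrightarrow> (\<forall>x x'. x' - x \<in> unit_steps \<longrightarrow> \<bar>S x - S x'\<bar> \<le> 2)"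

definition slope :: "'n::finite surface \<Rightarrow> int ^ 'n \<Rightarrow> int ^ 'n \<Rightarrow> int" where
  "slope S x e = S (x + e) - S x"

text \<open>The \<open>2(d - 1)\<close> slope arguments of \<open>F\<close> are indexed by the unit steps themselves.\<close>

definition F :: "(int ^ 'n::finite \<Rightarrow> int) \<Rightarrow> real \<Rightarrow> int" where
  "F a w = of_bool (\<forall>e\<in>unit_steps. a e > -2) *
     max (of_bool (\<exists>e\<in>unit_steps. a e = 2))
         (of_bool (real_of_int (\<Sum>e\<in>unit_steps. a e) + w > 0))"

definition evolve :: "('n::finite site \<Rightarrow> real) \<Rightarrow> 'n surface \<Rightarrow> 'n surface" where
  "evolve \<omega> S = (\<lambda>x. S x + F (slope S x) (\<omega> (x, S x)))"

definition blocked :: "('n::finite site \<Rightarrow> real) \<Rightarrow> 'n surface \<Rightarrow> bool" where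
  "blocked \<omega> S \<longleftrightarrow> (\<forall>x. evolve \<omega> S x = S x)"

text \<open>Meaningful for \<open>0 \<le> p \<le> 1\<close> only, since \<^const>\<open>bernoulli_pmf\<close> truncates its argument.\<close>

definition disorder_law :: "nat \<Rightarrow> real \<Rightarrow> real measure" where
  "disorder_law d p =
     distr (measure_pmf (bernoulli_pmf p)) borel (\<lambda>b. if b then -3 * (real d - 1) else 1/2)"

definition environment :: "real \<Rightarrow> ('n::finite site \<Rightarrow> real) measure" where
  "environment p = (\<Pi>\<^sub>M z\<in>UNIV. disorder_law (CARD('n) + 1) p)"

text \<open>
  The environment is the canonical realisation of the disorder by coordinates. The remaining facts
  show that its coordinates are independent with the prescribed marginals, and that an almost sure
  property of it holds almost surely for every independent family with these marginals, on any
  probability space.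
\<close>

lemma sets_disorder_law [simp, measurable_cong]: "sets (disorder_law d p) = sets borel"
  by (simp add: disorder_law_def)

lemma space_disorder_law [simp]: "space (disorder_law d p) = UNIV"
  by (simp add: disorder_law_def)

lemma prob_space_disorder_law: "prob_space (disorder_law d p)"
  unfolding disorder_law_def
  by (intro prob_space.prob_space_distr measure_pmf.prob_space_axioms) simp

lemma prob_space_environment: "prob_space (environment p)"
  unfolding environment_def by (intro prob_space_PiM prob_space_disorder_law)

lemma emeasure_disorder_law:
  assumes "0 \<le> p" "p \<le> 1" and [measurable]: "A \<in> sets borel"
  shows "emeasure (disorder_law d p) A =
    ennreal p * indicator A (-3 * (real d - 1)) + ennreal (1 - p) * indicator A (1/2)"
proof -
  have "emeasure (disorder_law d p) A = (\<integral>\<^sup>+x. indicator A x \<partial>disorder_law d p)"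
    by simp
  also have "\<dots> = (\<integral>\<^sup>+b. indicator A (if b then -3 * (real d - 1) else 1/2) \<partial>bernoulli_pmf p)"
    unfolding disorder_law_def by (subst nn_integral_distr) auto
  also have "\<dots> = indicator A (-3 * (real d - 1)) * ennreal p
      + indicator A (1/2) * ennreal (1 - p)"
    using assms by (subst nn_integral_bernoulli_pmf) auto
  finally show ?thesis by (simp add: mult.commute)
qed

lemma distr_environment_coordinate:
  "distr (environment p) borel (\<lambda>\<omega>. \<omega> (z :: 'n::finite site)) =
     disorder_law (CARD('n) + 1) p"
proof -
  interpret product_prob_space "\<lambda>_ :: 'n site. disorder_law (CARD('n) + 1) p" UNIV
    by (simp add: product_prob_space_def product_prob_space_axioms_def product_sigma_finite_def
        prob_space_disorder_law prob_space_imp_sigma_finite)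
  have "distr (environment p) borel (\<lambda>\<omega>. \<omega> z) =
      distr (environment p) (disorder_law (CARD('n) + 1) p) (\<lambda>\<omega>. \<omega> z)"
    by (rule distr_cong) auto
  also have "\<dots> = disorder_law (CARD('n) + 1) p"
    unfolding environment_def by (rule PiM_component) simp
  finally show ?thesis .
qed

lemma environment_marginals:
  fixes z :: "'n::finite site"
  assumes "0 \<le> p" "p \<le> 1"
  shows "\<P>(\<omega> in environment p. \<omega> z = -3 * real CARD('n)) = p"
    and "\<P>(\<omega> in environment p. \<omega> z = 1/2) = 1 - p"
proof -
  have [measurable]: "(\<lambda>\<omega>. \<omega> z) \<in> borel_measurable (environment p)"
    unfolding environment_def by measurable
  have *: "\<P>(\<omega> in environment p. \<omega> z = c) = measure (disorder_law (CARD('n) + 1) p) {c}" for c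
    unfolding distr_environment_coordinate[symmetric, of p z]
    by (subst measure_distr) (auto intro!: arg_cong[where f = "measure (environment p)"])
  show "\<P>(\<omega> in environment p. \<omega> z = -3 * real CARD('n)) = p"
    unfolding * using assms by (simp add: measure_def emeasure_disorder_law)
  show "\<P>(\<omega> in environment p. \<omega> z = 1/2) = 1 - p"
    unfolding * using assms by (simp add: measure_def emeasure_disorder_law)
qed

lemma environment_indep:
  "prob_space.indep_vars (environment p) (\<lambda>_. borel) (\<lambda>(z :: 'n::finite site) \<omega>. \<omega> z) UNIV"
proof -
  interpret prob_space "environment p :: ('n site \<Rightarrow> real) measure"
    by (rule prob_space_environment)
  have "random_variable borel (\<lambda>\<omega>. \<omega> z)" for z :: "'n site"
    unfolding environment_def by measurable
  moreover have "distr (environment p) (\<Pi>\<^sub>M z\<in>UNIV. borel) (\<lambda>\<omega>. \<lambda>z::'n site\<in>UNIV. \<omega> z) =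
      environment p"
    by (subst restrict_UNIV, rule distr_id2)
       (auto simp: environment_def intro!: sets_PiM_cong)
  ultimately show ?thesis
    by (subst indep_vars_iff_distr_eq_PiM)
       (simp_all add: distr_environment_coordinate, simp add: environment_def)
qed

lemma AE_environment_transfer:
  fixes M :: "'a measure" and X :: "'n::finite site \<Rightarrow> 'a \<Rightarrow> real"
  assumes p: "0 \<le> p" "p \<le> 1"
    and M: "prob_space M"
    and indep: "prob_space.indep_vars M (\<lambda>_. borel) X UNIV"
    and low: "\<And>z. \<P>(\<xi> in M. X z \<xi> = -3 * real CARD('n)) = p"
    and high: "\<And>z. \<P>(\<xi> in M. X z \<xi> = 1/2) = 1 - p"
    and Q: "AE \<omega> in environment p. Q \<omega>"
  shows "AE \<xi> in M. Q (\<lambda>z. X z \<xi>)"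
proof -
  interpret prob_space M by (rule M)
  have rv[measurable]: "X z \<in> borel_measurable M" for z
    using indep unfolding indep_vars_def by blast
  define a b :: real where "a = -3 * real CARD('n)" and "b = 1/2"
  have ab: "a \<noteq> b"
    unfolding a_def b_def by (smt (verit) of_nat_0_le_iff divide_pos_pos)
  have law: "distr M borel (X z) = disorder_law (CARD('n) + 1) p" for z
  proof (rule measure_eqI)
    fix A :: "real set" assume "A \<in> sets (distr M borel (X z))"
    then have [measurable]: "A \<in> sets borel" by simp
    have "\<P>(\<xi> in M. X z \<xi> = a \<or> X z \<xi> = b) =
        \<P>(\<xi> in M. X z \<xi> = a) + \<P>(\<xi> in M. X z \<xi> = b)"
      using ab by (subst finite_measure_Union[symmetric])
        (auto intro!: arg_cong[where f = prob])
    also have "\<dots> = 1" by (simp only: a_def b_def low high)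
    finally have two: "AE \<xi> in M. X z \<xi> = a \<or> X z \<xi> = b"
      by (subst (asm) prob_Collect_eq_1) auto
    have "emeasure (distr M borel (X z)) A = (\<integral>\<^sup>+\<xi>. indicator A (X z \<xi>) \<partial>M)"
      by (subst nn_integral_indicator[symmetric], simp, subst nn_integral_distr) auto
    also have "\<dots> = (\<integral>\<^sup>+\<xi>. indicator A a * indicator {\<xi> \<in> space M. X z \<xi> = a} \<xi>
        + indicator A b * indicator {\<xi> \<in> space M. X z \<xi> = b} \<xi> \<partial>M)"
      using two AE_space ab
      by (intro nn_integral_cong_AE) (elim AE_mp, rule AE_I2, auto simp: indicator_def)
    also have "\<dots> = indicator A a * emeasure M {\<xi> \<in> space M. X z \<xi> = a}
        + indicator A b * emeasure M {\<xi> \<in> space M. X z \<xi> = b}"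
      by (subst nn_integral_add) (auto simp: nn_integral_cmult_indicator)
    also have "\<dots> = indicator A a * ennreal p + indicator A b * ennreal (1 - p)"
      by (simp only: emeasure_eq_measure a_def b_def low high)
    finally show "emeasure (distr M borel (X z)) A = emeasure (disorder_law (CARD('n) + 1) p) A"
      using p by (simp add: emeasure_disorder_law a_def b_def mult.commute)
  qed simp
  have "distr M (\<Pi>\<^sub>M z\<in>UNIV. borel) (\<lambda>\<xi>. \<lambda>z\<in>UNIV. X z \<xi>) = environment p"
    using indep by (subst (asm) indep_vars_iff_distr_eq_PiM) (simp_all add: law environment_def)
  with Q have "AE \<omega> in distr M (\<Pi>\<^sub>M z\<in>UNIV. borel) (\<lambda>\<xi>. \<lambda>z\<in>UNIV. X z \<xi>). Q \<omega>"
    by (simp only:)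
  then have "AE \<xi> in M. Q (\<lambda>z\<in>UNIV. X z \<xi>)"
    by (rule AE_distrD[rotated]) measurable
  then show ?thesis by (simp only: restrict_UNIV)
qed

end

theory Submission
  imports Defs
begin

text \<open>
  Call a site pinned if its disorder takes the low value \<open>- 3 (d - 1)\<close>. A surface whose neighbouring
  heights differ by at most 1 has no slope equal to 2, and the sum of its \<open>2 (d - 1)\<close> slopes
  at a point is at most \<open>2 (d - 1)\<close>, too little to overcome a pinned site. So a 1-Lipschitz surface
  that only visits pinned sites is blocked (\<open>one_Lipschitz_pinned_blocked\<close>), and it suffices to find,
  for every integer \<open>h\<close>, such a surface above height \<open>h\<close>: finitely many surfaces would have bounded
  heights at the origin.

  The existence of these surfaces is Lipschitz percolation, proved by the duality of Dirr, Dondl,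
  Grimmett, Holroyd and Scheutzow. Consider the paths that start at height \<open>h\<close> and whose steps go
  either straight up into an unpinned site, or diagonally down, without restriction, to
  \<open>(x + e, y - 1)\<close> with a unit step \<open>e\<close>. If above every \<open>x\<close> the reachable heights are bounded, the
  surface just above the reachable sites is as desired (\<open>ex_one_Lipschitz_avoiding\<close>): the free
  diagonal steps make it 1-Lipschitz, and it meets no unpinned site, since an upward step would
  make that site reachable.

  Boundedness is a Peierls argument. A path that ends no lower than it starts has at least as many
  up steps as down steps, and a shortest path does not repeat sites. Hence a shortest path with
  \<open>N\<close> steps enters at least \<open>N / 2\<close> distinct unpinned sites, which has probability at most
  \<open>sqrt (1 - p) ^ N\<close>. With \<open>c\<close> possible steps and a fixed final column there are at most \<open>c ^ N\<close>
  such paths, because the sequence of steps determines the starting point. If \<open>c * sqrt (1 - p) < 1\<close>,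
  the bounds are summable in \<open>N\<close>, and by the Borel-Cantelli lemma the lengths of these paths, and
  with them the heights that they reach, are almost surely bounded (\<open>AE_reachable_bounded\<close>). The
  threshold is therefore \<open>1 - 1 / c\<^sup>2\<close>.
\<close>

section \<open>Pinned surfaces of small slope\<close>

lemma finite_unit_steps: "finite (unit_steps :: (int ^ 'n::finite) set)"
  by (simp add: unit_steps_def)

lemma card_unit_steps_le: "card (unit_steps :: (int ^ 'n::finite) set) \<le> 2 * CARD('n)"
proof -
  have "card (unit_steps :: (int ^ 'n) set) \<le> card (range (\<lambda>k::'n. axis k (1::int)))
      + card (range (\<lambda>k::'n. - axis k (1::int)))"
    unfolding unit_steps_def by (rule card_Un_le)
  also have "\<dots> \<le> CARD('n) + CARD('n)"
    by (intro add_mono card_image_le) auto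
  finally show ?thesis by simp
qed

lemma uminus_unit_steps: "e \<in> unit_steps \<Longrightarrow> - e \<in> unit_steps"
  by (auto simp: unit_steps_def)

definition one_Lipschitz :: "'n::finite surface \<Rightarrow> bool" where
  "one_Lipschitz S \<longleftrightarrow> (\<forall>x x'. x' - x \<in> unit_steps \<longrightarrow> \<bar>S x - S x'\<bar> \<le> 1)"

lemma one_Lipschitz_imp_two_Lipschitz: "one_Lipschitz S \<Longrightarrow> two_Lipschitz S"
  unfolding one_Lipschitz_def two_Lipschitz_def by force

text \<open>
  Both ways for the height at a point to grow are excluded: no slope is 2, and the slopes add
  up to at most \<open>2 (d - 1) < 3 (d - 1)\<close>.
\<close>

lemma one_Lipschitz_pinned_blocked:
  fixes S :: "'n::finite surface"
  assumes S: "one_Lipschitz S"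
    and pinned: "\<And>x. \<omega> (x, S x) = -3 * real CARD('n)"
  shows "blocked \<omega> S"
  unfolding blocked_def
proof
  fix x
  have slope_le: "slope S x e \<le> 1" if "e \<in> unit_steps" for e
  proof -
    have "(x + e) - x \<in> unit_steps" using that by simp
    then have "\<bar>S x - S (x + e)\<bar> \<le> 1" using S unfolding one_Lipschitz_def by blast
    then show ?thesis unfolding slope_def by linarith
  qed
  have "(\<Sum>e\<in>unit_steps. slope S x e) \<le> (\<Sum>e\<in>(unit_steps :: (int ^ 'n) set). 1)"
    by (rule sum_mono) (rule slope_le)
  also have "\<dots> \<le> 2 * int CARD('n)"
    using card_unit_steps_le[where 'n = 'n] by simp
  finally have "real_of_int (\<Sum>e\<in>unit_steps. slope S x e) \<le> 2 * real CARD('n)"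
    by linarith
  then have "\<not> real_of_int (\<Sum>e\<in>unit_steps. slope S x e) + \<omega> (x, S x) > 0"
    unfolding pinned by linarith
  moreover have "\<not> (\<exists>e\<in>unit_steps. slope S x e = 2)"
    using slope_le by force
  ultimately show "evolve \<omega> S x = S x"
    unfolding evolve_def F_def by simp
qed

section \<open>Admissible paths and the surface above them\<close>

definition lambda_steps :: "'n::finite site set" where
  "lambda_steps = insert (0, 1) ((\<lambda>e. (e, -1)) ` unit_steps)"

lemma finite_lambda_steps: "finite lambda_steps"
  by (simp add: lambda_steps_def finite_unit_steps)

lemma card_lambda_steps_pos: "card (lambda_steps :: 'n::finite site set) > 0"
  using finite_lambda_steps unfolding card_gt_0_iff lambda_steps_def by blast

text \<open>The set \<open>C\<close> holds the sites that may be entered from below, later the unpinned ones.\<close>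

definition admissible :: "'n::finite site set \<Rightarrow> ('n site \<times> 'n site) set" where
  "admissible C =
     {(z, z'). z' - z \<in> lambda_steps \<and> (z' - z = (0, 1) \<longrightarrow> z' \<in> C)}"

definition reachable :: "'n::finite site set \<Rightarrow> int \<Rightarrow> 'n site set" where
  "reachable C h = (admissible C)\<^sup>* `` {z. snd z = h}"

lemma reachable_start: "(x, h) \<in> reachable C h"
  unfolding reachable_def by auto

lemma reachable_step:
  "z \<in> reachable C h \<Longrightarrow> (z, z') \<in> admissible C \<Longrightarrow> z' \<in> reachable C h"
  unfolding reachable_def by (auto intro: rtrancl_into_rtrancl)

lemma reachable_up:
  "(x, y) \<in> reachable C h \<Longrightarrow> (x, y + 1) \<in> C \<Longrightarrow> (x, y + 1) \<in> reachable C h"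
  by (erule reachable_step) (simp add: admissible_def lambda_steps_def)

lemma reachable_down:
  "(x, y) \<in> reachable C h \<Longrightarrow> x' - x \<in> unit_steps \<Longrightarrow> (x', y - 1) \<in> reachable C h"
  by (erule reachable_step) (simp add: admissible_def lambda_steps_def)

text \<open>
  The surface lies one above the highest reachable height \<open>m x\<close> of each column. It is
  1-Lipschitz because a diagonal step leads from \<open>(x, m x)\<close> to height \<open>m x - 1\<close> in any neighbouring
  column, and it avoids \<open>C\<close> because otherwise an upward step would exceed \<open>m x\<close>.
\<close>

lemma ex_one_Lipschitz_avoiding:
  fixes C :: "'n::finite site set"
  assumes bounded: "\<And>x. \<exists>B. \<forall>y. (x, y) \<in> reachable C h \<longrightarrow> y \<le> B"
  shows "\<exists>S. one_Lipschitz S \<and> (\<forall>x. (x, S x) \<notin> C) \<and> (\<forall>x. h < S x)"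
proof -
  have "\<exists>m. (x, m) \<in> reachable C h \<and> (\<forall>y. (x, y) \<in> reachable C h \<longrightarrow> y \<le> m)" for x
  proof -
    obtain B where B: "\<And>y. (x, y) \<in> reachable C h \<Longrightarrow> y \<le> B"
      using bounded by blast
    define A where "A = {y. (x, y) \<in> reachable C h \<and> h \<le> y}"
    have "A \<subseteq> {h..B}" unfolding A_def using B by auto
    then have fin: "finite A" by (rule finite_subset) simp
    have h: "h \<in> A" unfolding A_def using reachable_start by blast
    then have "Max A \<in> A" using fin by (intro Max_in) auto
    moreover have "y \<le> Max A" if "(x, y) \<in> reachable C h" for y
    proof (cases "h \<le> y")
      case True
      then show ?thesis using that fin by (intro Max_ge) (auto simp: A_def)
    next
      case False
      then show ?thesis using Max_ge[OF fin h] by linarith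
    qed
    ultimately show ?thesis unfolding A_def by blast
  qed
  then obtain m where m: "\<And>x. (x, m x) \<in> reachable C h"
    and le_m: "\<And>x y. (x, y) \<in> reachable C h \<Longrightarrow> y \<le> m x"
    by metis
  have drop: "m x - 1 \<le> m x'" if "x' - x \<in> unit_steps" for x x'
    using le_m reachable_down[OF m that] by blast
  have "one_Lipschitz (\<lambda>x. m x + 1)"
    unfolding one_Lipschitz_def
  proof (intro allI impI)
    fix x x' :: "int ^ 'n"
    assume e: "x' - x \<in> unit_steps"
    then have "x - x' \<in> unit_steps" using uminus_unit_steps[of "x' - x"] by simp
    with e show "\<bar>m x + 1 - (m x' + 1)\<bar> \<le> 1"
      using drop[of x' x] drop[of x x'] by linarith
  qed
  moreover have "(x, m x + 1) \<notin> C" for x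
    using reachable_up[OF m] le_m[of x "m x + 1"] by force
  moreover have "h < m x + 1" for x
    using le_m[OF reachable_start, of x] by linarith
  ultimately show ?thesis by (intro exI[of _ "\<lambda>x. m x + 1"]) blast
qed

section \<open>Encoding paths by words\<close>

definition walk :: "'n::finite site \<Rightarrow> (nat \<Rightarrow> 'n site) \<Rightarrow> nat \<Rightarrow> 'n site" where
  "walk z g i = z + (\<Sum>j<i. g j)"

text \<open>
  A path of minimal length has no repeated site, since a loop could be cut out. Distinct sites are
  what makes the events along a path independent.
\<close>

lemma rtrancl_imp_inj_word:
  fixes C :: "'n::finite site set"
  assumes "(a, b) \<in> (admissible C)\<^sup>*"
  obtains N g where "g \<in> {..<N} \<rightarrow>\<^sub>E lambda_steps" "inj_on (walk a g) {..N}" "walk a g N = b"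
    "\<And>j. j < N \<Longrightarrow> g j = (0, 1) \<Longrightarrow> walk a g (Suc j) \<in> C"
proof -
  define N where "N = (LEAST N. (a, b) \<in> admissible C ^^ N)"
  have N: "(a, b) \<in> admissible C ^^ N"
    unfolding N_def using assms by (metis LeastI_ex rtrancl_imp_relpow)
  have N_least: "N \<le> k" if "(a, b) \<in> admissible C ^^ k" for k
    unfolding N_def by (rule Least_le) (rule that)
  from N obtain f where f: "f 0 = a" "f N = b"
    and f_step: "\<And>i. i < N \<Longrightarrow> (f i, f (Suc i)) \<in> admissible C"
    unfolding relpow_fun_conv by blast
  have no_repeat: "f i \<noteq> f j" if "i < j" "j \<le> N" for i j
  proof
    assume eq: "f i = f j"
    have "(a, f i) \<in> admissible C ^^ i"
      unfolding relpow_fun_conv using f f_step that by (intro exI[of _ f]) auto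
    moreover have "(f j, b) \<in> admissible C ^^ (N - j)"
      unfolding relpow_fun_conv using f f_step that
      by (intro exI[of _ "\<lambda>k. f (j + k)"]) auto
    ultimately have "(a, b) \<in> admissible C ^^ (i + (N - j))"
      using eq by (auto simp: relpow_add)
    then show False using N_least that by fastforce
  qed
  define g where "g = (\<lambda>j\<in>{..<N}. f (Suc j) - f j)"
  have walk: "walk a g i = f i" if "i \<le> N" for i
    using that
  proof (induction i)
    case 0
    then show ?case by (simp add: walk_def f)
  next
    case (Suc i)
    then have "a + sum g {..<i} = f i" by (simp add: walk_def)
    with Suc.prems show ?case
      by (simp add: walk_def g_def add.assoc[symmetric])
  qed
  show ?thesis
  proof (rule that)
    show "g \<in> {..<N} \<rightarrow>\<^sub>E lambda_steps"
      using f_step by (auto simp: g_def admissible_def)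
    have "inj_on f {..N}"
      by (rule linorder_inj_onI) (use no_repeat in auto)
    then show "inj_on (walk a g) {..N}"
      by (rule inj_on_cong[THEN iffD2, rotated]) (simp add: walk)
    show "walk a g N = b" by (simp add: walk f)
    fix j assume "j < N" "g j = (0, 1)"
    then show "walk a g (Suc j) \<in> C"
      using f_step[of j] walk[of "Suc j"] by (simp add: g_def admissible_def)
  qed
qed

text \<open>
  Reading a path backwards from its final column \<open>x\<close>: its word of steps and its initial height
  \<open>h\<close> leave no freedom for the starting point. Counting paths thus reduces to counting words.
\<close>

definition word_start :: "int ^ 'n::finite \<Rightarrow> int \<Rightarrow> nat \<Rightarrow> (nat \<Rightarrow> 'n site) \<Rightarrow> 'n site" where
  "word_start x h N g = (x - fst (\<Sum>j<N. g j), h)"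

definition rising_words ::
    "int ^ 'n::finite \<Rightarrow> int \<Rightarrow> nat \<Rightarrow> (nat \<Rightarrow> 'n site) set" where
  "rising_words x h N = {g \<in> {..<N} \<rightarrow>\<^sub>E lambda_steps.
     inj_on (walk (word_start x h N g) g) {..N} \<and> 0 \<le> snd (\<Sum>j<N. g j)}"

definition up_targets ::
    "int ^ 'n::finite \<Rightarrow> int \<Rightarrow> nat \<Rightarrow> (nat \<Rightarrow> 'n site) \<Rightarrow> 'n site set" where
  "up_targets x h N g = (\<lambda>j. walk (word_start x h N g) g (Suc j)) ` {j. j < N \<and> g j = (0, 1)}"

lemma reachable_imp_rising_word:
  assumes "(x, y) \<in> reachable C h" "h \<le> y"
  obtains N g where "g \<in> rising_words x h N" "up_targets x h N g \<subseteq> C" "y \<le> h + int N"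
proof -
  obtain a where a: "snd a = h" "(a, (x, y)) \<in> (admissible C)\<^sup>*"
    using assms(1) unfolding reachable_def by blast
  from rtrancl_imp_inj_word[OF a(2)] obtain N g where
    g: "g \<in> {..<N} \<rightarrow>\<^sub>E lambda_steps" "inj_on (walk a g) {..N}" "walk a g N = (x, y)"
    "\<And>j. j < N \<Longrightarrow> g j = (0, 1) \<Longrightarrow> walk a g (Suc j) \<in> C"
    by metis
  have start: "word_start x h N g = a"
    using g(3) a(1) by (auto simp: word_start_def walk_def prod_eq_iff)
  have y: "y = h + snd (\<Sum>j<N. g j)"
    using g(3) a(1) by (auto simp: walk_def prod_eq_iff)
  have "snd (\<Sum>j<N. g j) \<le> (\<Sum>j<N. 1)"
    unfolding snd_sum
  proof (rule sum_mono)
    fix j assume "j \<in> {..<N}"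
    then have "g j \<in> lambda_steps" using g(1) by (rule PiE_mem[rotated])
    then show "snd (g j) \<le> 1" by (auto simp: lambda_steps_def)
  qed
  then have "y \<le> h + int N" using y by simp
  moreover have "g \<in> rising_words x h N"
    using g y assms(2) by (simp add: rising_words_def start)
  moreover have "up_targets x h N g \<subseteq> C"
    using g(4) by (auto simp: up_targets_def start)
  ultimately show ?thesis by (rule that[rotated 2])
qed

lemma finite_rising_words: "finite (rising_words x h N)"
  by (rule finite_subset[of _ "{..<N} \<rightarrow>\<^sub>E lambda_steps"])
     (auto simp: rising_words_def intro!: finite_PiE finite_lambda_steps)

lemma card_rising_words_le:
  "card (rising_words x h N :: (nat \<Rightarrow> 'n site) set) \<le> card (lambda_steps :: 'n::finite site set) ^ N"
proof -
  have "card (rising_words x h N :: (nat \<Rightarrow> 'n site) set)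
      \<le> card ({..<N} \<rightarrow>\<^sub>E (lambda_steps :: 'n site set))"
    by (rule card_mono) (auto simp: rising_words_def intro!: finite_PiE finite_lambda_steps)
  then show ?thesis by (simp add: card_PiE)
qed

lemma finite_up_targets: "finite (up_targets x h N g)"
  by (simp add: up_targets_def)

text \<open>
  Up steps raise the height by 1 and all others lower it by 1, so in a word that does not descend
  overall at least half of the steps go up; as the walk is injective, they enter distinct sites.
\<close>

lemma card_up_targets_ge:
  fixes g :: "nat \<Rightarrow> 'n::finite site"
  assumes "g \<in> rising_words x h N"
  shows "N \<le> 2 * card (up_targets x h N g)"
proof -
  define J where "J = {j. j < N \<and> g j = (0, 1)}"
  have J: "J \<subseteq> {..<N}" by (auto simp: J_def)
  have "inj_on (walk (word_start x h N g) g) {..N}"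
    using assms by (simp add: rising_words_def)
  then have "inj_on (\<lambda>j. walk (word_start x h N g) g (Suc j)) J"
    by (intro inj_onI) (auto simp: J_def dest!: inj_onD)
  then have card: "card (up_targets x h N g) = card J"
    unfolding up_targets_def J_def by (rule card_image)
  have "0 \<le> (\<Sum>j<N. snd (g j))"
    using assms by (simp add: rising_words_def snd_sum)
  also have "\<dots> = (\<Sum>j<N. 2 * of_bool (j \<in> J) - 1)"
  proof (rule sum.cong)
    fix j assume j: "j \<in> {..<N}"
    then have "g j \<in> lambda_steps"
      using assms by (auto simp: rising_words_def)
    then show "snd (g j) = 2 * of_bool (j \<in> J) - 1"
      using j by (auto simp: J_def lambda_steps_def)
  qed simp
  also have "\<dots> = 2 * int (card J) - int N"
    using J by (simp add: sum_subtractf sum_distrib_left[symmetric] Int_absorb1 of_bool_def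
        sum.If_cases Int_def[symmetric])
  finally show ?thesis unfolding card by linarith
qed

section \<open>The Peierls bound on long paths\<close>

definition unpinned :: "('n::finite site \<Rightarrow> real) \<Rightarrow> 'n site set" where
  "unpinned \<omega> = {z. \<omega> z \<noteq> -3 * real CARD('n)}"

lemma sets_unpinned_superset:
  fixes T :: "'n::finite site set"
  assumes "finite T"
  shows "{\<omega> \<in> space (environment p). T \<subseteq> unpinned \<omega>} \<in> sets (environment p)"
proof -
  have [measurable]: "(\<lambda>\<omega>. \<omega> z) \<in> borel_measurable (environment p)" for z :: "'n site"
    unfolding environment_def by measurable
  have "{\<omega> \<in> space (environment p). T \<subseteq> unpinned \<omega>} =
      {\<omega> \<in> space (environment p). \<forall>z\<in>T. \<omega> z \<noteq> -3 * real CARD('n)}"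
    by (auto simp: unpinned_def)
  also have "\<dots> \<in> sets (environment p)"
    using assms by measurable
  finally show ?thesis .
qed

lemma prob_unpinned_superset:
  fixes T :: "'n::finite site set"
  assumes p: "0 \<le> p" "p \<le> 1" and T: "finite T"
  shows "\<P>(\<omega> in environment p. T \<subseteq> unpinned \<omega>) = (1 - p) ^ card T"
proof (cases "T = {}")
  case True
  interpret prob_space "environment p :: ('n site \<Rightarrow> real) measure"
    by (rule prob_space_environment)
  show ?thesis using True by (simp add: prob_space)
next
  case False
  interpret prob_space "environment p :: ('n site \<Rightarrow> real) measure"
    by (rule prob_space_environment)
  have [measurable]: "(\<lambda>\<omega>. \<omega> z) \<in> borel_measurable (environment p)" for z :: "'n site"
    unfolding environment_def by measurable
  define B :: "real set" where "B = - {-3 * real CARD('n)}"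
  have [measurable]: "B \<in> sets borel" by (simp add: B_def)
  have indep: "indep_vars (\<lambda>_. borel) (\<lambda>(z :: 'n site) \<omega>. \<omega> z) T"
    by (rule indep_vars_subset[OF environment_indep]) simp
  have single: "\<P>(\<omega> in environment p. \<omega> z \<in> B) = 1 - p" for z :: "'n site"
  proof -
    have "\<P>(\<omega> in environment p. \<not> \<omega> z = -3 * real CARD('n)) = 1 - p"
      by (subst prob_neg) (simp_all only: environment_marginals(1)[OF p], measurable)
    then show ?thesis by (simp add: B_def)
  qed
  have "\<P>(\<omega> in environment p. T \<subseteq> unpinned \<omega>) =
      prob (\<Inter>z\<in>T. (\<lambda>\<omega>. \<omega> z) -` B \<inter> space (environment p))"
    using False by (intro arg_cong[where f = prob]) (auto simp: unpinned_def B_def)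
  also have "\<dots> = (\<Prod>z\<in>T. prob ((\<lambda>\<omega>. \<omega> z) -` B \<inter> space (environment p)))"
    by (rule indep_varsD[OF indep]) (use False T in auto)
  also have "\<dots> = (\<Prod>z\<in>T. 1 - p)"
    using single by (intro prod.cong refl) (simp add: vimage_def Int_def conj_commute)
  finally show ?thesis by simp
qed

text \<open>
  All rising words of length \<open>N\<close> are covered here, whatever height above \<open>h\<close> they end at. A single sequence of events
  thus handles all heights in the column of \<open>x\<close>, and the number of words is finite.
\<close>

definition long_path :: "real \<Rightarrow> int ^ 'n::finite \<Rightarrow> int \<Rightarrow> nat \<Rightarrow> ('n site \<Rightarrow> real) set" where
  "long_path p x h N =
     (\<Union>g\<in>rising_words x h N. {\<omega> \<in> space (environment p). up_targets x h N g \<subseteq> unpinned \<omega>})"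

lemma sets_long_path: "long_path p x h N \<in> sets (environment p)"
  unfolding long_path_def
  by (intro sets.finite_UN finite_rising_words sets_unpinned_superset finite_up_targets)

text \<open>
  The union bound over at most \<open>c ^ N\<close> words, each of which asks for at least \<open>N / 2\<close> distinct
  unpinned sites; \<open>sqrt (1 - p)\<close> is the cost per step.
\<close>

lemma prob_long_path_le:
  fixes x :: "int ^ 'n::finite"
  assumes p: "0 \<le> p" "p \<le> 1"
  shows "measure (environment p) (long_path p x h N)
    \<le> (card (lambda_steps :: 'n site set) * sqrt (1 - p)) ^ N"
proof -
  interpret prob_space "environment p :: ('n site \<Rightarrow> real) measure"
    by (rule prob_space_environment)
  have "prob (long_path p x h N)
      \<le> (\<Sum>g\<in>rising_words x h N. \<P>(\<omega> in environment p. up_targets x h N g \<subseteq> unpinned \<omega>))"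
    unfolding long_path_def
    by (intro finite_measure_subadditive_finite finite_rising_words image_subsetI
        sets_unpinned_superset finite_up_targets)
  also have "\<dots> \<le> (\<Sum>g\<in>(rising_words x h N :: (nat \<Rightarrow> 'n site) set). sqrt (1 - p) ^ N)"
  proof (rule sum_mono)
    fix g :: "nat \<Rightarrow> 'n site"
    assume g: "g \<in> rising_words x h N"
    let ?u = "card (up_targets x h N g)"
    have "\<P>(\<omega> in environment p. up_targets x h N g \<subseteq> unpinned \<omega>) = (1 - p) ^ ?u"
      by (rule prob_unpinned_superset[OF p finite_up_targets])
    also have "\<dots> = sqrt (1 - p) ^ (2 * ?u)"
      using p by (simp add: power_mult)
    also have "\<dots> \<le> sqrt (1 - p) ^ N"
      using p card_up_targets_ge[OF g] by (intro power_decreasing) auto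
    finally show "\<P>(\<omega> in environment p. up_targets x h N g \<subseteq> unpinned \<omega>) \<le> sqrt (1 - p) ^ N" .
  qed
  also have "\<dots> = card (rising_words x h N :: (nat \<Rightarrow> 'n site) set) * sqrt (1 - p) ^ N"
    by simp
  also have "\<dots> \<le> card (lambda_steps :: 'n site set) ^ N * sqrt (1 - p) ^ N"
    using card_rising_words_le[of x h N] p by (intro mult_right_mono) (simp_all flip: of_nat_power)
  finally show ?thesis by (simp add: power_mult_distrib)
qed

text \<open>
  By Borel-Cantelli the rising paths into the column of \<open>x\<close> have bounded length, and a path of
  length \<open>N\<close> climbs at most \<open>N\<close>.
\<close>

lemma AE_reachable_bounded:
  fixes x :: "int ^ 'n::finite"
  assumes p: "0 \<le> p" "p \<le> 1"
    and small: "card (lambda_steps :: 'n site set) * sqrt (1 - p) < 1"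
  shows "AE \<omega> in environment p. \<exists>B. \<forall>y. (x, y) \<in> reachable (unpinned \<omega>) h \<longrightarrow> y \<le> B"
proof -
  interpret prob_space "environment p :: ('n site \<Rightarrow> real) measure"
    by (rule prob_space_environment)
  have "summable (\<lambda>N. prob (long_path p x h N))"
  proof (rule summable_comparison_test)
    show "\<exists>M. \<forall>N\<ge>M. norm (prob (long_path p x h N))
        \<le> (card (lambda_steps :: 'n site set) * sqrt (1 - p)) ^ N"
      using prob_long_path_le[OF p, of x h] by auto
    show "summable (\<lambda>N. (card (lambda_steps :: 'n site set) * sqrt (1 - p)) ^ N)"
      using small p by (intro summable_geometric) auto
  qed
  then have "AE \<omega> in environment p.
      eventually (\<lambda>N. \<omega> \<in> space (environment p) - long_path p x h N) sequentially"
    by (intro borel_cantelli_AE1 sets_long_path) (auto simp: emeasure_eq_measure)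
  then show ?thesis
  proof eventually_elim
    case (elim \<omega>)
    then obtain M where M: "\<And>N. N \<ge> M \<Longrightarrow> \<omega> \<in> space (environment p) - long_path p x h N"
      unfolding eventually_sequentially by blast
    have "y \<le> h + int M" if y: "(x, y) \<in> reachable (unpinned \<omega>) h" for y
    proof (cases "h \<le> y")
      case True
      with y obtain N g where g: "g \<in> rising_words x h N"
          "up_targets x h N g \<subseteq> unpinned \<omega>" "y \<le> h + int N"
        by (rule reachable_imp_rising_word)
      have "N < M"
      proof (rule ccontr)
        assume "\<not> N < M"
        then have "\<omega> \<in> space (environment p)" "\<omega> \<notin> long_path p x h N" using M[of N] by auto
        with g show False unfolding long_path_def by blast
      qed
      with g(3) show ?thesis by linarith
    qed simp
    then show ?case by blast
  qed
qed

theorem lemma4p1: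
  shows "\<exists>p\<^sub>0 < 1. \<forall>p. p\<^sub>0 < p \<and> 0 \<le> p \<and> p \<le> 1 \<longrightarrow>
    (AE \<omega> in (environment p :: ('n::finite site \<Rightarrow> real) measure).
       infinite {S :: 'n surface. two_Lipschitz S \<and> blocked \<omega> S})"
proof -
  define c where "c = real (card (lambda_steps :: 'n site set))"
  have c: "c > 0" unfolding c_def using card_lambda_steps_pos by simp
  show ?thesis
  proof (intro exI[of _ "1 - 1 / c\<^sup>2"] conjI allI impI)
    show "1 - 1 / c\<^sup>2 < 1" using c by simp
    fix p :: real
    assume "1 - 1 / c\<^sup>2 < p \<and> 0 \<le> p \<and> p \<le> 1"
    then have p: "0 \<le> p" "p \<le> 1" "1 - p < (1 / c)\<^sup>2"
      by (auto simp: power_divide)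
    have "sqrt (1 - p) < 1 / c"
      using p(3) c by (intro real_less_lsqrt) auto
    then have small: "c * sqrt (1 - p) < 1"
      using c by (simp add: field_simps)
    have "AE \<omega> in (environment p :: ('n site \<Rightarrow> real) measure).
        \<forall>h x. \<exists>B. \<forall>y. (x, y) \<in> reachable (unpinned \<omega>) h \<longrightarrow> y \<le> B"
      unfolding AE_all_countable
      by (intro allI AE_reachable_bounded p(1,2)) (use small in \<open>simp add: c_def\<close>)
    then show "AE \<omega> in (environment p :: ('n site \<Rightarrow> real) measure).
        infinite {S :: 'n surface. two_Lipschitz S \<and> blocked \<omega> S}"
    proof eventually_elim
      case (elim \<omega>)
      have above: "\<exists>S. two_Lipschitz S \<and> blocked \<omega> S \<and> h < S 0" for h
      proof -
        obtain S where S: "one_Lipschitz S" "\<And>x. (x, S x) \<notin> unpinned \<omega>" "\<And>x. h < S x"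
          using ex_one_Lipschitz_avoiding[of "unpinned \<omega>" h] elim by blast
        have "blocked \<omega> S"
          by (rule one_Lipschitz_pinned_blocked[OF S(1)]) (use S(2) in \<open>simp add: unpinned_def\<close>)
        with S show ?thesis using one_Lipschitz_imp_two_Lipschitz by blast
      qed
      show ?case
      proof
        let ?H = "(\<lambda>S. S 0) ` {S :: 'n surface. two_Lipschitz S \<and> blocked \<omega> S}"
        assume "finite {S :: 'n surface. two_Lipschitz S \<and> blocked \<omega> S}"
        then have fin: "finite ?H" by simp
        obtain S :: "'n surface" where S: "two_Lipschitz S" "blocked \<omega> S" "Max ?H < S 0"
          using above[of "Max ?H"] by blast
        then have "S 0 \<le> Max ?H"
          using fin by (intro Max_ge) auto
        with S(3) show False by simp
      qed
    qed
  qed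
qed

end
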